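(* Let $n$ be a positive integer, let $a,b,c$ be pairwise distinct odd primes and let $d,e$ be distinct odd primes. Put $A = 2^n abc$ and $B = 2^n de$, and suppose that $(A,B)$ is an amicable pair. Then \begin{align*} c(a+b)+ab &= 2^{-n}\bigl(B-(\varphi(A)+\varphi(B))\bigr),\\ (d+e)-(a+b+c) &= 2^{-n}\bigl(A-(\varphi(A)+\varphi(B))\bigr). \end{align*}
   Context: For a positive integer $m$, $\sigma(m)$ denotes the sum of all positive divisors of $m$, and $\varphi$ denotes Euler's totient function. Two positive integers $A$ and $B$ form an amicable pair if $\sigma(A)=\sigma(B)=A+B$ (equivalently, each is the sum of the proper divisors of the other). *)

theory Defs
  imports Complex_Main "HOL-Number_Theory.Totient"
begin

definition divisor_sum :: "nat \<Rightarrow> nat" where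
  "divisor_sum m = (\<Sum>k | k dvd m. k)"

definition amicable :: "nat \<Rightarrow> nat \<Rightarrow> bool" where
  "amicable A B \<longleftrightarrow>
     A > 0 \<and> B > 0 \<and> divisor_sum A = A + B \<and> divisor_sum B = A + B"

end

theory Submission
  imports Defs
begin

text \<open>
  Both identities restate the equality \<open>\<sigma>(A) = \<sigma>(B)\<close>. Since \<open>\<sigma>\<close> is multiplicative, cancelling
  \<open>\<sigma>(2^n)\<close> from it leaves \<open>(a + 1)(b + 1)(c + 1) = (d + 1)(e + 1)\<close>, that is,
  \<open>s\<^sub>1 + s\<^sub>2 + s\<^sub>3 = t\<^sub>1 + t\<^sub>2\<close> in terms of the elementary symmetric functions \<open>s\<^sub>i\<close> of \<open>a, b, c\<close>
  and \<open>t\<^sub>i\<close> of \<open>d, e\<close>. Multiplicativity of Euler's function gives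
  \<open>2(\<phi>(A) + \<phi>(B)) = 2^n ((a - 1)(b - 1)(c - 1) + (d - 1)(e - 1)) = 2^n (s\<^sub>3 - s\<^sub>2 + s\<^sub>1 + t\<^sub>2 - t\<^sub>1)\<close>,
  and replacing \<open>s\<^sub>1 - t\<^sub>1\<close> by \<open>t\<^sub>2 - s\<^sub>2 - s\<^sub>3\<close> turns this into
  \<open>\<phi>(A) + \<phi>(B) = 2^n (t\<^sub>2 - s\<^sub>2)\<close>. As \<open>A = 2^n s\<^sub>3\<close> and \<open>B = 2^n t\<^sub>2\<close>, the two right-hand sides of
  the theorem are \<open>s\<^sub>2\<close> and \<open>s\<^sub>3 + s\<^sub>2 - t\<^sub>2 = t\<^sub>1 - s\<^sub>1\<close>.
\<close>

lemma divisor_sum_pos: "m > 0 \<Longrightarrow> divisor_sum m > 0"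
  unfolding divisor_sum_def by (rule sum_pos2[of _ 1]) auto

text \<open>
  Sort the divisors of \<open>m p\<close> by whether \<open>p\<close> divides them: those that it does not divide are the
  divisors of \<open>m\<close>, and the others are \<open>p\<close> times these.
\<close>

lemma divisor_sum_mult_prime:
  assumes p: "prime p" and m: "m > 0" "\<not> p dvd m"
  shows "divisor_sum (m * p) = divisor_sum m * (p + 1)"
proof -
  let ?D = "{k. k dvd m}"
  have "{k. k dvd m * p} = ?D \<union> (\<lambda>k. k * p) ` ?D"
  proof (intro equalityI subsetI)
    fix k assume "k \<in> {k. k dvd m * p}"
    hence k: "k dvd m * p" by simp
    show "k \<in> ?D \<union> (\<lambda>k. k * p) ` ?D"
    proof (cases "p dvd k")
      case True
      then obtain j where "k = j * p" by (metis dvd_def mult.commute)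
      with k p show ?thesis by (auto dest: prime_gt_0_nat)
    next
      case False
      hence "coprime k p" using p by (meson coprime_commute prime_imp_coprime)
      with k show ?thesis by (simp add: coprime_dvd_mult_left_iff)
    qed
  qed auto
  moreover have "?D \<inter> (\<lambda>k. k * p) ` ?D = {}"
    using m by (auto dest: dvd_mult_right)
  moreover have "finite ?D" using m by simp
  moreover have "inj_on (\<lambda>k. k * p) ?D"
    using p by (auto simp: inj_on_def dest: prime_gt_0_nat)
  ultimately show ?thesis
    by (simp add: divisor_sum_def sum.union_disjoint sum.reindex sum_distrib_right[symmetric] distrib_left)
qed

lemma totient_mult_prime:
  assumes "prime p" "\<not> p dvd m"
  shows "real (totient (m * p)) = real (totient m) * (real p - 1)"
proof -
  have "coprime m p" using assms by (meson coprime_commute prime_imp_coprime)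
  thus ?thesis using assms prime_gt_0_nat[of p]
    by (simp add: totient_mult_coprime totient_prime of_nat_diff)
qed

lemma odd_prime_not_dvd_power2:
  assumes "prime p" "odd (p :: nat)"
  shows "\<not> p dvd 2 ^ n"
  using assms by (metis dvd_refl prime_dvd_power primes_dvd_imp_eq two_is_prime_nat)

theorem theorem2p3:
  fixes n a b c d e A B :: nat
  assumes "n > 0"
    and "prime a" "odd a" "prime b" "odd b" "prime c" "odd c"
    and "a \<noteq> b" "a \<noteq> c" "b \<noteq> c"
    and "prime d" "odd d" "prime e" "odd e" "d \<noteq> e"
    and "A = 2 ^ n * a * b * c"
    and "B = 2 ^ n * d * e"
    and "amicable A B"
  shows "(real c * (real a + real b) + real a * real b
           = 2 powi (- int n) * (real B - (real (totient A) + real (totient B)))) \<and>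
         ((real d + real e) - (real a + real b + real c)
           = 2 powi (- int n) * (real A - (real (totient A) + real (totient B))))"
proof -
  note pr = \<open>prime a\<close> \<open>prime b\<close> \<open>prime c\<close> \<open>prime d\<close> \<open>prime e\<close>
  have nd: "\<not> a dvd 2 ^ n" "\<not> b dvd 2 ^ n * a" "\<not> c dvd 2 ^ n * a * b"
           "\<not> d dvd 2 ^ n" "\<not> e dvd 2 ^ n * d"
    using assms odd_prime_not_dvd_power2
    by (auto simp: prime_dvd_mult_iff dest: primes_dvd_imp_eq)
  have pos: "a > 0" "b > 0" "d > 0"
    using pr by (auto intro: prime_gt_0_nat)

  have "divisor_sum A = divisor_sum (2 ^ n) * ((a + 1) * (b + 1) * (c + 1))"
    unfolding \<open>A = _\<close> using pr nd pos by (simp add: divisor_sum_mult_prime) (simp add: algebra_simps)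
  moreover have "divisor_sum B = divisor_sum (2 ^ n) * ((d + 1) * (e + 1))"
    unfolding \<open>B = _\<close> using pr nd pos by (simp add: divisor_sum_mult_prime) (simp add: algebra_simps)
  moreover have "divisor_sum A = divisor_sum B"
    using \<open>amicable A B\<close> by (simp add: amicable_def)
  ultimately have "(a + 1) * (b + 1) * (c + 1) = (d + 1) * (e + 1)"
    using divisor_sum_pos[of "2 ^ n"] by simp
  hence "real ((a + 1) * (b + 1) * (c + 1)) = real ((d + 1) * (e + 1))"
    by (rule arg_cong)
  hence sigma: "(real a + 1) * (real b + 1) * (real c + 1) = (real d + 1) * (real e + 1)"
    by (simp only: of_nat_mult of_nat_add of_nat_1)

  \<comment> \<open>Positivity of \<open>n\<close> enters here: it makes \<open>\<phi>(2^n)\<close> exactly half of \<open>2^n\<close>.\<close>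
  have tot2: "2 * real (totient (2 ^ n)) = 2 ^ n"
    using \<open>n > 0\<close> totient_prime_power_Suc[of 2 "n - 1"] by (cases n) simp_all
  have "real (totient A) = real (totient (2 ^ n)) * ((real a - 1) * (real b - 1) * (real c - 1))"
    unfolding \<open>A = _\<close> using pr nd by (simp add: totient_mult_prime)
  moreover have "real (totient B) = real (totient (2 ^ n)) * ((real d - 1) * (real e - 1))"
    unfolding \<open>B = _\<close> using pr nd by (simp add: totient_mult_prime)
  ultimately have "2 * (real (totient A) + real (totient B)) = 2 * real (totient (2 ^ n)) *
      ((real a - 1) * (real b - 1) * (real c - 1) + (real d - 1) * (real e - 1))"
    by (simp add: algebra_simps)
  also have "(real a - 1) * (real b - 1) * (real c - 1) + (real d - 1) * (real e - 1)
      = 2 * (real d * real e - (real c * (real a + real b) + real a * real b))"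
    using sigma by (simp add: algebra_simps)
  finally have phi: "real (totient A) + real (totient B)
      = 2 ^ n * (real d * real e - (real c * (real a + real b) + real a * real b))"
    unfolding tot2 by (simp add: algebra_simps)

  have cancel: "2 powi (- int n) * (2 ^ n * x) = x" for x :: real
    by (simp add: power_int_minus)
  have B: "real B - (real (totient A) + real (totient B))
      = 2 ^ n * (real c * (real a + real b) + real a * real b)"
    unfolding phi unfolding \<open>B = _\<close> by (simp add: algebra_simps)
  have "real A - (real (totient A) + real (totient B))
      = 2 ^ n * (real a * real b * real c
          + (real c * (real a + real b) + real a * real b) - real d * real e)"
    unfolding phi unfolding \<open>A = _\<close> by (simp add: algebra_simps)
  also have "real a * real b * real c
      + (real c * (real a + real b) + real a * real b) - real d * real e
      = (real d + real e) - (real a + real b + real c)"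
    using sigma by (simp add: algebra_simps)
  finally have A: "real A - (real (totient A) + real (totient B))
      = 2 ^ n * ((real d + real e) - (real a + real b + real c))" .
  show ?thesis unfolding A B cancel by simp
qed

end
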